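(* Let $X$ be a locally compact metrizable topological space with a fixed compatible metric $d$, and let $\mathcal F=\{f_1,\dots,f_m\}$ be an iterated function system on $X$ with compact dynamics. Then the chain graph of the Hutchinson map $H_{\mathcal F}:\mathcal K(X)\to\mathcal K(X)$ has at least as many nodes (in the sense of cardinality) as the chain graph of $\mathcal F$. In particular, if $H_{\mathcal F}$ has a unique chain node, then so does $\mathcal F$.
   Context: An iterated function system (IFS) on a locally compact metric space $(Y,d_Y)$ is a finite collection $\mathcal F=\{f_1,\dots,f_m\}$, $m\ge1$, of continuous maps $f_i:Y\to Y$. For a finite word $I=i_1\dots i_k$ ($k\ge 0$) in the alphabet $\{1,\dots,m\}$, $|I|=k$ and $\Phi^I_{\mathcal F}=f_{i_1}\circ\dots\circ f_{i_k}$ (the identity for the empty word). The orbit of $x$ is $\mathcal O_{\mathcal F}(x)=\{\Phi^I_{\mathcal F}(x): I \text{ a finite word}\}$, which contains $x$. A set $A\subset Y$ is $H$-invariant if $\bigcup_{i=1}^m f_i(A)=A$. With $N_\varepsilon(A)=\{y: d_Y(y,A)<\varepsilon\}$, $A$ attracts $K\subset Y$ if for every $\varepsilon>0$ there is $\tau>0$ such that $\Phi^I_{\mathcal F}(K)\subset N_\varepsilon(A)$ for every word $I$ with $|I|\ge\tau$. A global attractor of $\mathcal F$ is a non-empty compact $H$-invariant subset of $Y$ that attracts every compact subset of $Y$. $\mathcal F$ has compact dynamics if it has a global attractor. Chains. For $\varepsilon>0$, an $\varepsilon$-chain from $x$ to $y$ is a finite sequence $x=x_0,x_1,\dots,x_k=y$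 of points of $Y$ ($k\ge 0$) together with indices $i_0,\dots,i_{k-1}\in\{1,\dots,m\}$ such that $d_Y(f_{i_n}(x_n),x_{n+1})<\varepsilon$ for $n=0,\dots,k-1$. The point $y$ is downstream from $x$ if for every $\varepsilon>0$ there is an $\varepsilon$-chain from $x$ to $y$. Two points are chain-equivalent if each is downstream from the other. The chain-recurrent set is the set of $x\in Y$ such that $x$ is chain-equivalent to $z$ for every $z\in\mathcal O_{\mathcal F}(x)$. Chain-equivalence is an equivalence relation on the chain-recurrent set; its equivalence classes are the chain nodes. The chain graph is the directed graph having the chain nodes as its nodes, with an edge from a node $M$ to a distinct node $N$ when some point of $N$ is downstream from some point of $M$. Hutchinson map. $\mathcal K(X)$ is the space of all non-empty compact subsets of $X$, with the Hausdorff metric $d_H(A,B)=\max\{\sup_{a\in A}d(a,B),\sup_{b\in B}d(b,A)\}$; it is locally compact when $X$ is. $H_{\mathcal F}:\mathcal K(X)\to\mathcal K(X)$ is $H_{\mathcal F}(K)=\bigcup_{i=1}^m f_i(K)$, regarded as an IFS with a single map on $(\mathcal K(X),d_H)$; its chains, chain nodes and chain graph are those of this one-map IFS. *)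

theory Defs
  imports "HOL-Analysis.Analysis" "HOL-Library.Equipollence" "Graph_Theory.Pair_Digraph"
begin

section \<open>Iterated function systems\<close>

text \<open>
  A metric space is a value of type \<^typ>\<open>'a metric\<close>, so that both the phase space and the
  hyperspace of its compact subsets are instances. A system of \<open>m\<close> maps on it is a family
  \<open>f\<close> of which only the members with index in \<open>{1..m}\<close> and only their values on the carrier
  are relevant. Finite words are lists of indices.
\<close>

definition ifs :: "'a metric \<Rightarrow> nat \<Rightarrow> (nat \<Rightarrow> 'a \<Rightarrow> 'a) \<Rightarrow> bool" where
  "ifs Y m f \<longleftrightarrow> locally_compact_space (mtopology_of Y) \<and> m \<ge> 1 \<and>
     (\<forall>i\<in>{1..m}. continuous_map (mtopology_of Y) (mtopology_of Y) (f i))"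

primrec word_map :: "(nat \<Rightarrow> 'a \<Rightarrow> 'a) \<Rightarrow> nat list \<Rightarrow> 'a \<Rightarrow> 'a" where
  "word_map f [] = id"
| "word_map f (i # I) = f i \<circ> word_map f I"

definition orbit :: "nat \<Rightarrow> (nat \<Rightarrow> 'a \<Rightarrow> 'a) \<Rightarrow> 'a \<Rightarrow> 'a set" where
  "orbit m f x = {word_map f I x | I. I \<in> lists {1..m}}"

definition hutchinson :: "nat \<Rightarrow> (nat \<Rightarrow> 'a \<Rightarrow> 'a) \<Rightarrow> 'a set \<Rightarrow> 'a set" where
  "hutchinson m f K = (\<Union>i\<in>{1..m}. f i ` K)"

section \<open>Global attractors\<close>

text \<open>
  For \<open>A = {}\<close> the infimum is unspecified; below, \<open>point_set_dist\<close> is only used with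
  non-empty \<open>A\<close>.
\<close>

definition point_set_dist :: "'a metric \<Rightarrow> 'a \<Rightarrow> 'a set \<Rightarrow> real" where
  "point_set_dist Y y A = (INF a\<in>A. mdist Y y a)"

definition metric_nbhd :: "'a metric \<Rightarrow> real \<Rightarrow> 'a set \<Rightarrow> 'a set" where
  "metric_nbhd Y \<epsilon> A = {y \<in> mspace Y. point_set_dist Y y A < \<epsilon>}"

definition attracts :: "'a metric \<Rightarrow> nat \<Rightarrow> (nat \<Rightarrow> 'a \<Rightarrow> 'a) \<Rightarrow> 'a set \<Rightarrow> 'a set \<Rightarrow> bool" where
  "attracts Y m f A K \<longleftrightarrow>
     (\<forall>\<epsilon>>0. \<exists>\<tau>>0. \<forall>I\<in>lists {1..m}. length I \<ge> \<tau> \<longrightarrow> word_map f I ` K \<subseteq> metric_nbhd Y \<epsilon> A)"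

definition global_attractor :: "'a metric \<Rightarrow> nat \<Rightarrow> (nat \<Rightarrow> 'a \<Rightarrow> 'a) \<Rightarrow> 'a set \<Rightarrow> bool" where
  "global_attractor Y m f A \<longleftrightarrow>
     A \<noteq> {} \<and> compactin (mtopology_of Y) A \<and> hutchinson m f A = A \<and>
     (\<forall>K. compactin (mtopology_of Y) K \<longrightarrow> attracts Y m f A K)"

definition compact_dynamics :: "'a metric \<Rightarrow> nat \<Rightarrow> (nat \<Rightarrow> 'a \<Rightarrow> 'a) \<Rightarrow> bool" where
  "compact_dynamics Y m f \<longleftrightarrow> (\<exists>A. global_attractor Y m f A)"

section \<open>Chains, chain nodes and the chain graph\<close>

definition has_chain ::
  "'a metric \<Rightarrow> nat \<Rightarrow> (nat \<Rightarrow> 'a \<Rightarrow> 'a) \<Rightarrow> real \<Rightarrow> 'a \<Rightarrow> 'a \<Rightarrow> bool" where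
  "has_chain Y m f \<epsilon> x y \<longleftrightarrow>
     (\<exists>(k::nat) (p :: nat \<Rightarrow> 'a) (i :: nat \<Rightarrow> nat).
        p 0 = x \<and> p k = y \<and> (\<forall>n\<le>k. p n \<in> mspace Y) \<and>
        (\<forall>n<k. i n \<in> {1..m} \<and> mdist Y (f (i n) (p n)) (p (Suc n)) < \<epsilon>))"

definition downstream :: "'a metric \<Rightarrow> nat \<Rightarrow> (nat \<Rightarrow> 'a \<Rightarrow> 'a) \<Rightarrow> 'a \<Rightarrow> 'a \<Rightarrow> bool" where
  "downstream Y m f x y \<longleftrightarrow> (\<forall>\<epsilon>>0. has_chain Y m f \<epsilon> x y)"

definition chain_equivalent :: "'a metric \<Rightarrow> nat \<Rightarrow> (nat \<Rightarrow> 'a \<Rightarrow> 'a) \<Rightarrow> 'a \<Rightarrow> 'a \<Rightarrow> bool" where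
  "chain_equivalent Y m f x y \<longleftrightarrow> downstream Y m f x y \<and> downstream Y m f y x"

definition chain_recurrent_set :: "'a metric \<Rightarrow> nat \<Rightarrow> (nat \<Rightarrow> 'a \<Rightarrow> 'a) \<Rightarrow> 'a set" where
  "chain_recurrent_set Y m f = {x \<in> mspace Y. \<forall>z\<in>orbit m f x. chain_equivalent Y m f x z}"

definition chain_nodes :: "'a metric \<Rightarrow> nat \<Rightarrow> (nat \<Rightarrow> 'a \<Rightarrow> 'a) \<Rightarrow> 'a set set" where
  "chain_nodes Y m f = chain_recurrent_set Y m f //
     {(x, y). x \<in> chain_recurrent_set Y m f \<and> y \<in> chain_recurrent_set Y m f \<and>
              chain_equivalent Y m f x y}"

definition chain_graph ::
  "'a metric \<Rightarrow> nat \<Rightarrow> (nat \<Rightarrow> 'a \<Rightarrow> 'a) \<Rightarrow> 'a set pair_pre_digraph" where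
  "chain_graph Y m f =
     \<lparr> pverts = chain_nodes Y m f,
       parcs = {(M, N). M \<in> chain_nodes Y m f \<and> N \<in> chain_nodes Y m f \<and> M \<noteq> N \<and>
                        (\<exists>x\<in>M. \<exists>y\<in>N. downstream Y m f x y)} \<rparr>"

section \<open>The hyperspace of non-empty compact sets and the Hutchinson map\<close>

definition compact_hyperspace :: "'a metric \<Rightarrow> 'a set set" where
  "compact_hyperspace X = {K. K \<noteq> {} \<and> compactin (mtopology_of X) K}"

text \<open>
  A value of type \<^typ>\<open>'a metric\<close> needs a distance function that is symmetric and
  non-negative even off the carrier; there the Hausdorff distance is set to \<open>0\<close>.
\<close>

definition hausdorff_dist :: "'a metric \<Rightarrow> 'a set \<Rightarrow> 'a set \<Rightarrow> real" where
  "hausdorff_dist X A B =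
     (if A \<in> compact_hyperspace X \<and> B \<in> compact_hyperspace X
      then max (SUP a\<in>A. point_set_dist X a B) (SUP b\<in>B. point_set_dist X b A)
      else 0)"

definition hausdorff_metric :: "'a metric \<Rightarrow> 'a set metric" where
  "hausdorff_metric X = metric (compact_hyperspace X, hausdorff_dist X)"

definition hutchinson_chain_graph ::
  "'a metric \<Rightarrow> nat \<Rightarrow> (nat \<Rightarrow> 'a \<Rightarrow> 'a) \<Rightarrow> 'a set set pair_pre_digraph" where
  "hutchinson_chain_graph X m f = chain_graph (hausdorff_metric X) 1 (\<lambda>_. hutchinson m f)"

text \<open>
  The constructor \<^const>\<open>metric\<close> is meaningful only for metric spaces, so we check that
  the Hausdorff distance is a metric on the hyperspace.
\<close>

lemma compact_hyperspaceD:
  assumes "A \<in> compact_hyperspace X"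
  shows "A \<noteq> {}" "compactin (mtopology_of X) A" "A \<subseteq> mspace X"
  using assms compactin_subset_topspace[of "mtopology_of X" A]
  by (auto simp: compact_hyperspace_def)

lemma bdd_below_mdist: "bdd_below (mdist X x ` B)"
  by (rule bdd_belowI[of _ 0]) auto

lemma point_set_dist_le: "b \<in> B \<Longrightarrow> point_set_dist X x B \<le> mdist X x b"
  unfolding point_set_dist_def by (rule cINF_lower[OF bdd_below_mdist])

lemma point_set_dist_nonneg: "B \<noteq> {} \<Longrightarrow> 0 \<le> point_set_dist X x B"
  unfolding point_set_dist_def by (rule cINF_greatest) auto

lemma point_set_dist_approx:
  assumes "B \<noteq> {}" "e > 0"
  shows "\<exists>b\<in>B. mdist X x b < point_set_dist X x B + e"
proof -
  have "(INF b\<in>B. mdist X x b) < point_set_dist X x B + e"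
    using assms by (simp add: point_set_dist_def)
  then show ?thesis
    using cINF_less_iff[OF assms(1) bdd_below_mdist, of X x] by blast
qed

lemma bdd_above_point_set_dist:
  assumes "A \<in> compact_hyperspace X" "B \<in> compact_hyperspace X"
  shows "bdd_above ((\<lambda>a. point_set_dist X a B) ` A)"
proof -
  interpret Metric_space "mspace X" "mdist X" by simp
  note AB = compact_hyperspaceD[OF assms(1)] compact_hyperspaceD[OF assms(2)]
  obtain b where b: "b \<in> B" using AB by auto
  have "mbounded A"
    using AB by (intro compactin_imp_mbounded) (simp add: mtopology_of_def)
  then obtain c r where cr: "A \<subseteq> mcball c r" by (auto simp: mbounded_def)
  have "point_set_dist X a B \<le> r + mdist X c b" if "a \<in> A" for a
  proof -
    have a: "a \<in> mspace X" "c \<in> mspace X" "b \<in> mspace X" "mdist X c a \<le> r"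
      using that cr b AB by auto
    have "point_set_dist X a B \<le> mdist X a b" using b by (rule point_set_dist_le)
    also have "\<dots> \<le> mdist X c a + mdist X c b" using a triangle'' by blast
    finally show ?thesis using a by linarith
  qed
  then show ?thesis by (intro bdd_aboveI2) auto
qed

lemma hausdorff_dist_ge:
  assumes "A \<in> compact_hyperspace X" "B \<in> compact_hyperspace X"
  shows "a \<in> A \<Longrightarrow> point_set_dist X a B \<le> hausdorff_dist X A B"
    and "b \<in> B \<Longrightarrow> point_set_dist X b A \<le> hausdorff_dist X A B"
  using assms
    cSUP_upper[OF _ bdd_above_point_set_dist[OF assms], of a]
    cSUP_upper[OF _ bdd_above_point_set_dist[OF assms(2,1)], of b]
  by (auto simp: hausdorff_dist_def le_max_iff_disj)

lemma hausdorff_dist_le: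
  assumes "A \<in> compact_hyperspace X" "B \<in> compact_hyperspace X"
    and "\<And>a. a \<in> A \<Longrightarrow> point_set_dist X a B \<le> r"
    and "\<And>b. b \<in> B \<Longrightarrow> point_set_dist X b A \<le> r"
  shows "hausdorff_dist X A B \<le> r"
  using assms compact_hyperspaceD(1)[of A X] compact_hyperspaceD(1)[of B X]
  by (auto simp: hausdorff_dist_def intro!: cSUP_least)

lemma hausdorff_dist_commute: "hausdorff_dist X A B = hausdorff_dist X B A"
  by (auto simp: hausdorff_dist_def max.commute)

lemma hausdorff_dist_nonneg: "0 \<le> hausdorff_dist X A B"
proof (cases "A \<in> compact_hyperspace X \<and> B \<in> compact_hyperspace X")
  case True
  then obtain a where "a \<in> A" using compact_hyperspaceD by blast
  then have "point_set_dist X a B \<le> hausdorff_dist X A B"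
    using True by (intro hausdorff_dist_ge) auto
  then show ?thesis
    using point_set_dist_nonneg[of B X a] compact_hyperspaceD(1)[of B X] True by linarith
qed (auto simp: hausdorff_dist_def)

lemma hausdorff_dist_zero_subset:
  assumes "A \<in> compact_hyperspace X" "B \<in> compact_hyperspace X" "hausdorff_dist X A B = 0"
  shows "A \<subseteq> B"
proof
  interpret Metric_space "mspace X" "mdist X" by simp
  note AB = compact_hyperspaceD[OF assms(1)] compact_hyperspaceD[OF assms(2)]
  have "closedin mtopology B"
    using AB by (intro compactin_imp_closedin Hausdorff_space_mtopology)
      (simp add: mtopology_of_def)
  then have clB: "mtopology closure_of B = B" by (rule closure_of_closedin)
  fix a assume a: "a \<in> A"
  have "point_set_dist X a B \<le> 0" using hausdorff_dist_ge(1)[OF assms(1,2) a] assms(3) by simp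
  then have "\<exists>b\<in>B. mdist X a b < e" if "e > 0" for e
    using point_set_dist_approx[OF AB(4) that, of X a] by (meson add_le_same_cancel2 order_less_le_trans)
  moreover have "a \<in> mspace X" "B \<subseteq> mspace X" using a AB by auto
  ultimately have "a \<in> mtopology closure_of B"
    unfolding metric_closure_of mem_Collect_eq in_mball by blast
  then show "a \<in> B" using clB by simp
qed

lemma point_set_dist_triangle:
  assumes "A \<in> compact_hyperspace X" "B \<in> compact_hyperspace X" "C \<in> compact_hyperspace X"
    and "a \<in> A"
  shows "point_set_dist X a C \<le> hausdorff_dist X A B + hausdorff_dist X B C"
proof (rule field_le_epsilon)
  fix e :: real assume e: "e > 0"
  note ABC = compact_hyperspaceD[OF assms(1)] compact_hyperspaceD[OF assms(2)]
    compact_hyperspaceD[OF assms(3)]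
  obtain b where b: "b \<in> B" "mdist X a b < point_set_dist X a B + e/2"
    using point_set_dist_approx[of B "e/2" X a] ABC e by auto
  obtain c where c: "c \<in> C" "mdist X b c < point_set_dist X b C + e/2"
    using point_set_dist_approx[of C "e/2" X b] ABC e by auto
  have "point_set_dist X a C \<le> mdist X a c" using c by (intro point_set_dist_le)
  also have "\<dots> \<le> mdist X a b + mdist X b c"
    using b c ABC assms(4) by (intro mdist_triangle) auto
  finally show "point_set_dist X a C \<le> hausdorff_dist X A B + hausdorff_dist X B C + e"
    using b c hausdorff_dist_ge(1)[OF assms(1,2,4)] hausdorff_dist_ge(1)[OF assms(2,3) b(1)]
    by linarith
qed

lemma Metric_space_hausdorff: "Metric_space (compact_hyperspace X) (hausdorff_dist X)"
proof
  fix A B assume AB: "A \<in> compact_hyperspace X" "B \<in> compact_hyperspace X"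
  show "hausdorff_dist X A B = 0 \<longleftrightarrow> A = B"
  proof
    assume "hausdorff_dist X A B = 0"
    then show "A = B"
      using AB hausdorff_dist_zero_subset hausdorff_dist_commute by (metis subset_antisym)
  next
    assume "A = B"
    moreover have "point_set_dist X a A \<le> 0" if "a \<in> A" for a
    proof -
      have "a \<in> mspace X" using compact_hyperspaceD(3)[OF AB(1)] that by blast
      then have "mdist X a a = 0" by simp
      then show ?thesis using point_set_dist_le[OF that, of X a] by linarith
    qed
    ultimately have "hausdorff_dist X A B \<le> 0"
      using AB by (intro hausdorff_dist_le) auto
    then show "hausdorff_dist X A B = 0" using hausdorff_dist_nonneg[of X A B] by linarith
  qed
next
  fix A B C
  assume ABC: "A \<in> compact_hyperspace X" "B \<in> compact_hyperspace X" "C \<in> compact_hyperspace X"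
  show "hausdorff_dist X A C \<le> hausdorff_dist X A B + hausdorff_dist X B C"
  proof (rule hausdorff_dist_le[OF ABC(1,3)])
    fix a assume "a \<in> A"
    then show "point_set_dist X a C \<le> hausdorff_dist X A B + hausdorff_dist X B C"
      by (rule point_set_dist_triangle[OF ABC])
  next
    fix c assume "c \<in> C"
    from point_set_dist_triangle[OF ABC(3,2,1) this]
    show "point_set_dist X c A \<le> hausdorff_dist X A B + hausdorff_dist X B C"
      unfolding hausdorff_dist_commute[of X C B] hausdorff_dist_commute[of X B A] by linarith
  qed
qed (rule hausdorff_dist_nonneg hausdorff_dist_commute)+

lemma mspace_hausdorff_metric [simp]: "mspace (hausdorff_metric X) = compact_hyperspace X"
  unfolding hausdorff_metric_def by (rule Metric_space.mspace_metric[OF Metric_space_hausdorff])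

lemma mdist_hausdorff_metric [simp]: "mdist (hausdorff_metric X) = hausdorff_dist X"
  unfolding hausdorff_metric_def by (rule Metric_space.mdist_metric[OF Metric_space_hausdorff])

lemma hutchinson_in_hyperspace:
  assumes "ifs X m f" "K \<in> compact_hyperspace X"
  shows "hutchinson m f K \<in> compact_hyperspace X"
proof -
  have "compactin (mtopology_of X) (\<Union>i\<in>{1..m}. f i ` K)"
    using assms compact_hyperspaceD(2)[OF assms(2)]
    by (intro compactin_Union) (auto simp: ifs_def intro: image_compactin)
  then show ?thesis
    using assms by (auto simp: compact_hyperspace_def hutchinson_def ifs_def)
qed

end

theory Submission
  imports Defs
begin

text \<open>
  A chain node of the system is recorded by what lies downstream of it. For a chain-recurrent
  point \<open>x\<close> let \<open>D x\<close> be the set of all points downstream from \<open>x\<close>; two chain-recurrent points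
  have the same downstream set exactly when they lie in the same node. The map sending the node
  of \<open>x\<close> to the node of \<open>D x\<close> turns out to be a well-defined injection into the nodes of the
  Hutchinson map.

  It is well defined because \<open>D x\<close> is a fixed point of the Hutchinson map, and fixed points are
  chain-recurrent (\<open>fixed_point_recurrent\<close>). This is where compact dynamics enters: long chains
  with small jumps end near the attractor \<open>A\<close> (\<open>capture\<close>), and a chain-recurrent point reaches
  everything downstream from it by arbitrarily long chains
  (\<open>long_chain_from_recurrent\<close>). Hence \<open>D x\<close>, which is always closed, lies inside \<open>A\<close> and is
  compact. It is always mapped into itself, and it is covered by its images because the
  penultimate points of finer and finer chains ending at a point \<open>y\<close> of \<open>D x\<close> accumulate
  at a preimage of \<open>y\<close> that is again downstream from \<open>x\<close> (\<open>hutchinson_downstream_set\<close>).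

  It is injective because a chain of compact sets from \<open>K\<close> to \<open>L\<close> can be traced back, point by
  point, from any \<open>y\<close> in \<open>L\<close> to some point of \<open>K\<close> (\<open>trace_back_hyperspace_chain\<close>). With
  \<open>K = D x\<close> this shows that every point of \<open>L\<close> is downstream from \<open>x\<close>. So if \<open>D x\<close> and \<open>D y\<close> are
  chain-equivalent in the hyperspace, each contains the other.

  The injection shows that the system has at most as many nodes as the Hutchinson map; for the
  statement on uniqueness a node of the system must also exist. By Zorn's lemma and compactness of \<open>A\<close>, some point of \<open>A\<close> has a minimal
  downstream set within \<open>A\<close>, and such a point is chain-recurrent
  (\<open>chain_recurrent_point_exists\<close>).
\<close>

section \<open>Chains as iterated pseudo-steps\<close>

definition pseudo_step ::
  "'a metric \<Rightarrow> nat \<Rightarrow> (nat \<Rightarrow> 'a \<Rightarrow> 'a) \<Rightarrow> real \<Rightarrow> 'a \<Rightarrow> 'a \<Rightarrow> bool" where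
  "pseudo_step Y m f \<epsilon> x y \<longleftrightarrow>
     x \<in> mspace Y \<and> y \<in> mspace Y \<and> (\<exists>i\<in>{1..m}. mdist Y (f i x) y < \<epsilon>)"

text \<open>
  As powers of a relation, chains inherit concatenation and splitting. The powers of length zero
  do not check membership in the carrier, so the initial point has to be constrained separately.
\<close>

lemma has_chain_iff_relpowp:
  "has_chain Y m f \<epsilon> x y \<longleftrightarrow> x \<in> mspace Y \<and> (\<exists>k. (pseudo_step Y m f \<epsilon> ^^ k) x y)"
proof
  assume "has_chain Y m f \<epsilon> x y"
  then obtain k p i where *: "p 0 = x" "p k = y" "\<And>n. n \<le> k \<Longrightarrow> p n \<in> mspace Y"
    "\<And>n. n < k \<Longrightarrow> i n \<in> {1..m} \<and> mdist Y (f (i n) (p n)) (p (Suc n)) < \<epsilon>"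
    unfolding has_chain_def by blast
  have "pseudo_step Y m f \<epsilon> (p n) (p (Suc n))" if "n < k" for n
    using *(3)[of n] *(3)[of "Suc n"] *(4)[of n] that unfolding pseudo_step_def by auto
  then have "(pseudo_step Y m f \<epsilon> ^^ k) x y"
    unfolding relpowp_fun_conv using *(1,2) by (intro exI[of _ p]) simp
  then show "x \<in> mspace Y \<and> (\<exists>k. (pseudo_step Y m f \<epsilon> ^^ k) x y)"
    using *(1) *(3)[of 0] by blast
next
  assume "x \<in> mspace Y \<and> (\<exists>k. (pseudo_step Y m f \<epsilon> ^^ k) x y)"
  then obtain k p where *: "x \<in> mspace Y" "p 0 = x" "p k = y"
    "\<And>n. n < k \<Longrightarrow> pseudo_step Y m f \<epsilon> (p n) (p (Suc n))"
    unfolding relpowp_fun_conv by blast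
  have p: "p n \<in> mspace Y" if "n \<le> k" for n
    using that *(1,2) *(4)[of "n - 1"] by (cases n) (auto simp: pseudo_step_def)
  have "\<forall>n. \<exists>i. n < k \<longrightarrow> i \<in> {1..m} \<and> mdist Y (f i (p n)) (p (Suc n)) < \<epsilon>"
    using *(4) unfolding pseudo_step_def by blast
  then obtain i where
    "\<forall>n. n < k \<longrightarrow> i n \<in> {1..m} \<and> mdist Y (f (i n) (p n)) (p (Suc n)) < \<epsilon>"
    by metis
  then show "has_chain Y m f \<epsilon> x y"
    unfolding has_chain_def using *(2,3) p by blast
qed

lemma relpowp_pseudo_step_mono:
  "(pseudo_step Y m f \<epsilon> ^^ n) x y \<Longrightarrow> \<epsilon> \<le> \<epsilon>' \<Longrightarrow> (pseudo_step Y m f \<epsilon>' ^^ n) x y"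
  by (erule relpowp_mono[rotated]) (force simp: pseudo_step_def)

lemma relpowp_pseudo_step_in_space:
  "(pseudo_step Y m f \<epsilon> ^^ n) x y \<Longrightarrow> x \<in> mspace Y \<Longrightarrow> y \<in> mspace Y"
  by (cases n) (auto simp: pseudo_step_def)

text \<open>
  Only the last jump sees the endpoint, so moving it enlarges that jump alone. A chain of length
  zero has no jump to absorb the move, hence the successor in the exponent.
\<close>

lemma pseudo_chain_perturb_end:
  assumes "(pseudo_step Y m f \<epsilon> ^^ Suc n) x z" "mdist Y z y < \<delta>" "y \<in> mspace Y"
    and "\<And>i w. i \<in> {1..m} \<Longrightarrow> w \<in> mspace Y \<Longrightarrow> f i w \<in> mspace Y"
  shows "(pseudo_step Y m f (\<epsilon> + \<delta>) ^^ Suc n) x y"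
proof -
  obtain w where w: "(pseudo_step Y m f \<epsilon> ^^ n) x w" "pseudo_step Y m f \<epsilon> w z"
    using assms(1) by auto
  then obtain i where i: "i \<in> {1..m}" "mdist Y (f i w) z < \<epsilon>" "w \<in> mspace Y" "z \<in> mspace Y"
    by (auto simp: pseudo_step_def)
  have "mdist Y (f i w) y \<le> mdist Y (f i w) z + mdist Y z y"
    using i assms by (intro mdist_triangle) auto
  then have "pseudo_step Y m f (\<epsilon> + \<delta>) w y"
    using i assms(2,3) unfolding pseudo_step_def by force
  moreover have "0 \<le> mdist Y z y" by simp
  then have "(pseudo_step Y m f (\<epsilon> + \<delta>) ^^ n) x w"
    using w(1) assms(2) by (intro relpowp_pseudo_step_mono[OF w(1)]) linarith
  ultimately show ?thesis by auto
qed

section \<open>Downstream sets\<close>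

definition downstream_set :: "'a metric \<Rightarrow> nat \<Rightarrow> (nat \<Rightarrow> 'a \<Rightarrow> 'a) \<Rightarrow> 'a \<Rightarrow> 'a set" where
  "downstream_set Y m f x = {y. downstream Y m f x y}"

lemma downstream_refl: "x \<in> mspace Y \<Longrightarrow> downstream Y m f x x"
  unfolding downstream_def has_chain_iff_relpowp by (metis relpowp_0_I)

lemma downstream_trans:
  assumes "downstream Y m f x y" "downstream Y m f y z"
  shows "downstream Y m f x z"
  using assms unfolding downstream_def has_chain_iff_relpowp by (meson relpowp_trans)

lemma downstream_set_mono:
  "downstream Y m f x y \<Longrightarrow> downstream_set Y m f y \<subseteq> downstream_set Y m f x"
  unfolding downstream_set_def by (auto intro: downstream_trans)

lemma downstream_set_eq_iff:
  assumes "x \<in> mspace Y" "y \<in> mspace Y"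
  shows "downstream_set Y m f x = downstream_set Y m f y \<longleftrightarrow> chain_equivalent Y m f x y"
  using assms downstream_refl[of x Y m f] downstream_refl[of y Y m f]
    downstream_set_mono[of Y m f x y] downstream_set_mono[of Y m f y x]
  unfolding chain_equivalent_def downstream_set_def by blast

lemma chain_equivalent_on_recurrent_set:
  "equiv (chain_recurrent_set Y m f)
     {(x, y). x \<in> chain_recurrent_set Y m f \<and> y \<in> chain_recurrent_set Y m f \<and>
              chain_equivalent Y m f x y}"
proof (rule equivI)
  show "refl_on (chain_recurrent_set Y m f)
     {(x, y). x \<in> chain_recurrent_set Y m f \<and> y \<in> chain_recurrent_set Y m f \<and>
              chain_equivalent Y m f x y}"
    by (auto simp: refl_on_def chain_equivalent_def chain_recurrent_set_def
        intro: downstream_refl)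
qed (auto simp: sym_def trans_def chain_equivalent_def intro: downstream_trans)

locale iterated_function_system =
  fixes X :: "'a metric" and m :: nat and f :: "nat \<Rightarrow> 'a \<Rightarrow> 'a"
  assumes ifs: "ifs X m f"
begin

sublocale Metric_space "mspace X" "mdist X" by simp

lemma topology_of_metric: "mtopology_of X = mtopology"
  by (simp add: mtopology_of_def)

lemma continuous: "i \<in> {1..m} \<Longrightarrow> continuous_map mtopology mtopology (f i)"
  using ifs by (auto simp: ifs_def topology_of_metric)

lemma maps_into_space: "i \<in> {1..m} \<Longrightarrow> x \<in> mspace X \<Longrightarrow> f i x \<in> mspace X"
  using continuous_map_image_subset_topspace[OF continuous, of i] by auto

lemma one_in_index: "1 \<in> {1..m}"
  using ifs by (auto simp: ifs_def)

abbreviation step where "step \<equiv> pseudo_step X m f"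
abbreviation D where "D \<equiv> downstream_set X m f"
abbreviation R where "R \<equiv> chain_recurrent_set X m f"

lemma pseudo_step_to_image:
  assumes "i \<in> {1..m}" "x \<in> mspace X" "\<epsilon> > 0"
  shows "step \<epsilon> x (f i x)"
proof -
  have "mdist X (f i x) (f i x) < \<epsilon>" using maps_into_space[OF assms(1,2)] assms(3) by simp
  then show ?thesis using assms maps_into_space unfolding pseudo_step_def by blast
qed

lemma perturb_end:
  "(step \<epsilon> ^^ Suc n) x z \<Longrightarrow> mdist X z y < \<delta> \<Longrightarrow> y \<in> mspace X \<Longrightarrow>
    (step (\<epsilon> + \<delta>) ^^ Suc n) x y"
  by (rule pseudo_chain_perturb_end) (auto intro: maps_into_space)

lemma in_downstream_set_iff:
  "y \<in> D x \<longleftrightarrow> x \<in> mspace X \<and> (\<forall>\<epsilon>>0. \<exists>n. (step \<epsilon> ^^ n) x y)"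
  unfolding downstream_set_def downstream_def has_chain_iff_relpowp
  using zero_less_one by blast

lemma downstream_set_subset_space: "D x \<subseteq> mspace X"
  unfolding in_downstream_set_iff subset_iff
  using relpowp_pseudo_step_in_space zero_less_one by metis

lemma mem_closedin_if_approximated:
  assumes "closedin mtopology S" "y \<in> mspace X"
    and "\<And>e. e > 0 \<Longrightarrow> \<exists>v\<in>S. mdist X v y < e"
  shows "y \<in> S"
proof -
  have "y \<in> mtopology closure_of S"
    using assms(2,3) closedin_subset[OF assms(1)]
    unfolding metric_closure_of in_mball mem_Collect_eq by (metis commute subsetD topspace_mtopology)
  then show ?thesis using assms(1) by (simp add: closure_of_closedin)
qed

text \<open>
  A diagonal choice: points satisfying \<open>P\<close> with ever smaller tolerance accumulate in \<open>K\<close>, and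
  monotonicity lets one index be fine enough both for \<open>P\<close> and for the distance.
\<close>

lemma cluster_point:
  assumes "compactin mtopology K"
    and "\<And>e::real. e > 0 \<Longrightarrow> \<exists>w\<in>K. P e w"
    and mono: "\<And>e e' w. P e w \<Longrightarrow> e \<le> e' \<Longrightarrow> P e' w"
  shows "\<exists>l\<in>K. \<forall>e>0. \<exists>w. P e w \<and> mdist X w l < e"
proof -
  have "\<exists>w\<in>K. P (inverse (real (Suc n))) w" for n using assms(2) by simp
  then obtain w where w: "\<And>n. w n \<in> K" "\<And>n. P (inverse (real (Suc n))) (w n)" by metis
  have "range w \<subseteq> K" using w(1) by blast
  then obtain l r where l: "l \<in> K" "strict_mono r" "limitin mtopology (w \<circ> r) l sequentially"
    using assms(1) unfolding compactin_sequentially by meson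
  have "\<exists>w. P e w \<and> mdist X w l < e" if e: "e > 0" for e
  proof -
    obtain N1 where N1: "inverse (real (Suc N1)) < e" using reals_Archimedean[OF e] by blast
    have "\<exists>N2. \<forall>n\<ge>N2. mdist X (w (r n)) l < e"
      using l(3) e unfolding limitin_metric eventually_sequentially comp_def by blast
    then obtain N2 where N2: "\<And>n. n \<ge> N2 \<Longrightarrow> mdist X (w (r n)) l < e" by blast
    let ?n = "max N1 N2"
    have "N1 \<le> r ?n" using seq_suble[OF l(2), of ?n] by simp
    then have "inverse (real (Suc (r ?n))) \<le> inverse (real (Suc N1))"
      by (intro le_imp_inverse_le) auto
    then have "inverse (real (Suc (r ?n))) \<le> e" using N1 by linarith
    then have "P e (w (r ?n))" by (rule mono[OF w(2)])
    then show ?thesis using N2[of ?n] by auto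
  qed
  then show ?thesis using l(1) by blast
qed

text \<open>
  A point close to a point downstream from \<open>x\<close> is reached by moving the end of a chain.
\<close>

lemma closedin_downstream_set: "closedin mtopology (D x)"
  unfolding closedin_metric
proof (intro conjI allI impI downstream_set_subset_space)
  fix y assume y: "y \<in> mspace X - D x"
  show "\<exists>r>0. disjnt (D x) (mball y r)"
  proof (cases "x \<in> mspace X")
    case False
    then have "D x = {}" by (auto simp: in_downstream_set_iff)
    then show ?thesis by (auto intro: exI[of _ 1])
  next
    case True
    then obtain e where e: "e > 0" "\<nexists>n. (step e ^^ n) x y"
      using y by (auto simp: in_downstream_set_iff)
    have "(step e ^^ 0) x x" by simp
    then have "x \<noteq> y" using e by metis
    then have pos: "mdist X y x > 0" using True y by simp
    have "disjnt (D x) (mball y (min (e/2) (mdist X y x)))"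
    proof (rule ccontr)
      assume "\<not> ?thesis"
      then obtain z where z: "z \<in> D x" "mdist X y z < e/2" "mdist X y z < mdist X y x"
        by (auto simp: disjnt_iff)
      obtain n where n: "(step (e/2) ^^ n) x z"
        using z(1) e(1) unfolding in_downstream_set_iff by (metis half_gt_zero)
      \<comment> \<open>a chain of length zero would force \<open>z = x\<close>, which lies too far from \<open>y\<close>\<close>
      have "n \<noteq> 0" using n z(3) by (metis less_irrefl relpowp_0_E)
      then obtain k where k: "n = Suc k" by (cases n) auto
      have "(step (e/2 + e/2) ^^ Suc k) x y"
        using n z(2) y unfolding k by (intro perturb_end) (auto simp: commute)
      then have "(step e ^^ Suc k) x y" by (simp only: field_sum_of_halves)
      then show False using e(2) by blast
    qed
    then show ?thesis using pos e(1) by (intro exI[of _ "min (e/2) (mdist X y x)"]) auto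
  qed
qed

lemma hutchinson_downstream_subset: "hutchinson m f (D x) \<subseteq> D x"
proof
  fix z assume "z \<in> hutchinson m f (D x)"
  then obtain i y where i: "i \<in> {1..m}" "y \<in> D x" "z = f i y"
    by (auto simp: hutchinson_def)
  then have y: "y \<in> mspace X" and z: "z \<in> mspace X"
    using downstream_set_subset_space maps_into_space by auto
  have "\<exists>n. (step e ^^ n) x z" if "e > 0" for e
  proof -
    have "\<exists>n. (step e ^^ n) x y" using i(2) that by (simp add: in_downstream_set_iff)
    then obtain n where "(step e ^^ n) x y" ..
    moreover have "step e y z" using pseudo_step_to_image[OF i(1) y that] i(3) by simp
    ultimately show ?thesis using relpowp_Suc_I by metis
  qed
  then show "z \<in> D x" using i(2) unfolding in_downstream_set_iff by blast
qed

lemma word_map_chain: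
  assumes "I \<in> lists {1..m}" "x \<in> mspace X" "\<epsilon> > 0"
  shows "(step \<epsilon> ^^ length I) x (word_map f I x) \<and> word_map f I x \<in> mspace X"
  using assms(1)
proof (induction I)
  case Nil
  then show ?case using assms by simp
next
  case (Cons i I)
  then have I: "(step \<epsilon> ^^ length I) x (word_map f I x)" "word_map f I x \<in> mspace X"
    and i: "i \<in> {1..m}" by auto
  show ?case
    using I(1) pseudo_step_to_image[OF i I(2) assms(3)] maps_into_space[OF i I(2)] by auto
qed

lemma chain_recurrentI:
  assumes "x \<in> mspace X" "\<And>z. z \<in> orbit m f x \<Longrightarrow> x \<in> D z"
  shows "x \<in> R"
proof -
  have "z \<in> D x" if z: "z \<in> orbit m f x" for z
    using z assms(1) word_map_chain unfolding in_downstream_set_iff orbit_def by blast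
  then show ?thesis
    using assms unfolding chain_recurrent_set_def chain_equivalent_def downstream_set_def by auto
qed

text \<open>
  A chain-recurrent point may first follow a true orbit for as long as desired and then return
  to itself, so every point downstream from it is reached by arbitrarily long chains.
\<close>

lemma long_chain_from_recurrent:
  assumes "x \<in> R" "y \<in> D x" "\<epsilon> > 0"
  obtains n where "n \<ge> N" "(step \<epsilon> ^^ n) x y"
proof -
  let ?I = "replicate N (1::nat)"
  have x: "x \<in> mspace X" using assms(2) by (simp add: in_downstream_set_iff)
  have I: "?I \<in> lists {1..m}" using one_in_index by auto
  have 1: "(step \<epsilon> ^^ N) x (word_map f ?I x)"
    using word_map_chain[OF I x assms(3)] by simp
  have "word_map f ?I x \<in> orbit m f x" using I unfolding orbit_def by blast
  then have "x \<in> D (word_map f ?I x)"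
    using assms(1)
    unfolding chain_recurrent_set_def chain_equivalent_def downstream_set_def by blast
  then obtain k l where "(step \<epsilon> ^^ k) (word_map f ?I x) x" "(step \<epsilon> ^^ l) x y"
    using assms(2,3) unfolding in_downstream_set_iff by blast
  then have "(step \<epsilon> ^^ (N + (k + l))) x y"
    using 1 by (blast intro: relpowp_trans)
  then show thesis using that[of "N + (k + l)"] by simp
qed

section \<open>Shadowing of short chains\<close>

text \<open>
  Uniform continuity at the points of a compact set: the second point may lie outside it,
  which is what pseudo-orbits require.
\<close>

lemma uniformly_continuous_near_compact:
  assumes "compactin mtopology K" "i \<in> {1..m}" "\<delta> > 0"
  obtains \<eta> where "\<eta> > 0"
    "\<And>x y. x \<in> K \<Longrightarrow> y \<in> mspace X \<Longrightarrow> mdist X x y < \<eta> \<Longrightarrow> mdist X (f i x) (f i y) < \<delta>"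
proof -
  define U where "U x = {y \<in> mspace X. f i y \<in> mball (f i x) (\<delta>/2)}" for x
  have K: "K \<subseteq> mspace X" using compactin_subset_topspace[OF assms(1)] by simp
  have U: "openin mtopology (U x)" for x
    using openin_continuous_map_preimage[OF continuous[OF assms(2)] openin_mball]
    unfolding U_def topspace_mtopology .
  have "x \<in> U x" if "x \<in> K" for x
    using that K maps_into_space[OF assms(2)] assms(3) unfolding U_def by auto
  then have "K \<subseteq> \<Union>(U ` K)" by blast
  then have "\<exists>\<eta>>0. \<forall>x\<in>K. \<exists>V\<in>U ` K. mball x \<eta> \<subseteq> V"
    by (rule lebesgue_number[OF assms(1)]) (use U in auto)
  then obtain \<eta> where \<eta>: "\<eta> > 0" "\<And>x. x \<in> K \<Longrightarrow> \<exists>V\<in>U ` K. mball x \<eta> \<subseteq> V"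
    by blast
  have "mdist X (f i x) (f i y) < \<delta>" if xy: "x \<in> K" "y \<in> mspace X" "mdist X x y < \<eta>" for x y
  proof -
    obtain c where c: "c \<in> K" "mball x \<eta> \<subseteq> U c" using \<eta>(2)[OF xy(1)] by blast
    moreover have "x \<in> mball x \<eta>" "y \<in> mball x \<eta>" using xy K \<eta>(1) by auto
    ultimately have "x \<in> U c" "y \<in> U c" by auto
    then have "f i x \<in> mspace X" "f i y \<in> mspace X" "f i c \<in> mspace X"
      "mdist X (f i c) (f i x) < \<delta>/2" "mdist X (f i c) (f i y) < \<delta>/2"
      unfolding U_def by auto
    then show ?thesis using triangle''[of "f i x" "f i c" "f i y"] by linarith
  qed
  then show thesis by (rule that[OF \<eta>(1)])
qed

lemma compactin_hutchinson:
  "compactin mtopology K \<Longrightarrow> compactin mtopology (hutchinson m f K)"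
  unfolding hutchinson_def using image_compactin[OF _ continuous]
  by (intro compactin_Union) blast+

text \<open>
  A single tolerance serves the jump and the deviation already accumulated; it works for all
  maps at once since there are finitely many of them.
\<close>

lemma shadowing_step:
  assumes "compactin mtopology K" "\<delta> > 0"
  obtains \<eta> where "\<eta> > 0"
    "\<And>x y z. x \<in> K \<Longrightarrow> mdist X x y < \<eta> \<Longrightarrow> step \<eta> y z \<Longrightarrow>
       \<exists>v\<in>hutchinson m f K. mdist X v z < \<delta>"
proof -
  have "\<exists>\<eta>>0. \<forall>x\<in>K. \<forall>y\<in>mspace X. mdist X x y < \<eta> \<longrightarrow> mdist X (f i x) (f i y) < \<delta>/2"
    if "i \<in> {1..m}" for i
    using uniformly_continuous_near_compact[OF assms(1) that half_gt_zero[OF assms(2)]] by metis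
  then obtain h where h: "\<And>i. i \<in> {1..m} \<Longrightarrow> h i > 0"
    "\<And>i x y. i \<in> {1..m} \<Longrightarrow> x \<in> K \<Longrightarrow> y \<in> mspace X \<Longrightarrow> mdist X x y < h i \<Longrightarrow>
       mdist X (f i x) (f i y) < \<delta>/2"
    by metis
  define \<eta> where "\<eta> = min (\<delta>/2) (Min (h ` {1..m}))"
  have ne: "{1..m} \<noteq> {}" using one_in_index by auto
  have \<eta>: "\<eta> > 0" "\<eta> \<le> \<delta>/2" "\<And>i. i \<in> {1..m} \<Longrightarrow> \<eta> \<le> h i"
    using assms(2) h(1) ne unfolding \<eta>_def by (auto simp: Min_gr_iff min.coboundedI2)
  have "\<exists>v\<in>hutchinson m f K. mdist X v z < \<delta>"
    if xy: "x \<in> K" "mdist X x y < \<eta>" "step \<eta> y z" for x y z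
  proof -
    obtain i where i: "i \<in> {1..m}" "mdist X (f i y) z < \<eta>" "y \<in> mspace X" "z \<in> mspace X"
      using xy(3) by (auto simp: pseudo_step_def)
    have x: "x \<in> mspace X" using xy(1) compactin_subset_topspace[OF assms(1)] by auto
    have "mdist X (f i x) (f i y) < \<delta>/2"
      using h(2)[OF i(1) xy(1) i(3)] xy(2) \<eta>(3)[OF i(1)] by linarith
    moreover have "mdist X (f i x) z \<le> mdist X (f i x) (f i y) + mdist X (f i y) z"
      using i x by (intro triangle maps_into_space)
    ultimately have "mdist X (f i x) z < \<delta>" using i(2) \<eta>(2) by linarith
    then show ?thesis using i(1) xy(1) unfolding hutchinson_def by blast
  qed
  then show thesis by (rule that[OF \<eta>(1)])
qed

text \<open>
  For a fixed length, all true orbits from \<open>K\<close> stay in the compact images of \<open>K\<close>, so the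
  deviation can be controlled step by step. The tolerance depends on the length.
\<close>

lemma shadowing:
  assumes "compactin mtopology K" "\<delta> > 0"
  shows "\<exists>\<epsilon>>0. \<forall>x\<in>K. \<forall>y. (step \<epsilon> ^^ n) x y \<longrightarrow>
    (\<exists>v\<in>(hutchinson m f ^^ n) K. mdist X v y < \<delta>)"
  using assms(2)
proof (induction n arbitrary: \<delta>)
  case 0
  have "K \<subseteq> mspace X" using compactin_subset_topspace[OF assms(1)] by simp
  then have "\<forall>x\<in>K. mdist X x x < \<delta>" using 0 by auto
  then show ?case by (intro exI[of _ 1]) auto
next
  case (Suc n)
  let ?L = "(hutchinson m f ^^ n) K"
  have "compactin mtopology ?L"
    by (induction n) (auto intro: assms(1) compactin_hutchinson)
  then obtain \<eta> where \<eta>: "\<eta> > 0"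
    "\<And>x y z. x \<in> ?L \<Longrightarrow> mdist X x y < \<eta> \<Longrightarrow> step \<eta> y z \<Longrightarrow>
       \<exists>v\<in>hutchinson m f ?L. mdist X v z < \<delta>"
    using shadowing_step Suc.prems by metis
  obtain e where e: "e > 0" "\<And>x y. x \<in> K \<Longrightarrow> (step e ^^ n) x y \<Longrightarrow> \<exists>v\<in>?L. mdist X v y < \<eta>"
    using Suc.IH[OF \<eta>(1)] by blast
  have "\<exists>v\<in>hutchinson m f ?L. mdist X v z < \<delta>"
    if x: "x \<in> K" and c: "(step (min e \<eta>) ^^ Suc n) x z" for x z
  proof -
    obtain y where y: "(step (min e \<eta>) ^^ n) x y" "step (min e \<eta>) y z" using c by auto
    have "(step e ^^ n) x y" using y(1) by (rule relpowp_pseudo_step_mono) simp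
    moreover have "step \<eta> y z" using y(2) by (auto simp: pseudo_step_def)
    ultimately show ?thesis using e(2)[OF x] \<eta>(2) by blast
  qed
  then show ?case using e(1) \<eta>(1) by (intro exI[of _ "min e \<eta>"]) auto
qed

lemma hutchinson_funpow_words:
  "v \<in> (hutchinson m f ^^ n) K \<Longrightarrow> \<exists>I\<in>lists {1..m}. length I = n \<and> v \<in> word_map f I ` K"
proof (induction n arbitrary: v)
  case 0
  then show ?case by (intro bexI[of _ "[]"]) auto
next
  case (Suc n)
  then obtain i w where i: "i \<in> {1..m}" "w \<in> (hutchinson m f ^^ n) K" "v = f i w"
    unfolding funpow.simps o_apply hutchinson_def[of m f "(_ ^^ _) _"] by blast
  obtain I where "I \<in> lists {1..m}" "length I = n" "w \<in> word_map f I ` K"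
    using Suc.IH[OF i(2)] by blast
  then show ?case using i by (intro bexI[of _ "i # I"]) auto
qed

end

section \<open>Capture of long chains by the attractor\<close>

locale ifs_with_attractor = iterated_function_system +
  fixes A :: "'a set"
  assumes attractor: "global_attractor X m f A"
begin

lemma attractor_nonempty: "A \<noteq> {}"
  and attractor_compact: "compactin mtopology A"
  and attractor_invariant: "hutchinson m f A = A"
  using attractor unfolding global_attractor_def topology_of_metric by blast+

lemma attractor_subset_space: "A \<subseteq> mspace X"
  using compactin_subset_topspace[OF attractor_compact] by simp

lemma attracts_compact:
  assumes "compactin mtopology K" "\<rho> > 0"
  obtains \<tau> where "\<tau> > 0"
    "\<And>n v. n \<ge> \<tau> \<Longrightarrow> v \<in> (hutchinson m f ^^ n) K \<Longrightarrow> \<exists>a\<in>A. mdist X v a < \<rho>"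
proof -
  have "attracts X m f A K"
    using attractor assms(1) unfolding global_attractor_def topology_of_metric by blast
  then have "\<exists>\<tau>>0. \<forall>I\<in>lists {1..m}. length I \<ge> \<tau> \<longrightarrow>
      word_map f I ` K \<subseteq> metric_nbhd X (\<rho>/2) A"
    unfolding attracts_def by (elim allE[of _ "\<rho>/2"]) (simp add: assms(2))
  then obtain \<tau> where \<tau>: "\<tau> > 0"
    "\<forall>I\<in>lists {1..m}. length I \<ge> \<tau> \<longrightarrow> word_map f I ` K \<subseteq> metric_nbhd X (\<rho>/2) A"
    by (elim exE conjE)
  have "\<exists>a\<in>A. mdist X v a < \<rho>" if n: "n \<ge> \<tau>" and v: "v \<in> (hutchinson m f ^^ n) K" for n v
  proof -
    obtain I where "I \<in> lists {1..m}" "length I = n" "v \<in> word_map f I ` K"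
      using hutchinson_funpow_words[OF v] by blast
    then have "point_set_dist X v A < \<rho>/2"
      using \<tau>(2) n unfolding metric_nbhd_def by blast
    then show ?thesis
      using point_set_dist_approx[OF attractor_nonempty half_gt_zero[OF assms(2)], of X v]
      by force
  qed
  then show thesis by (rule that[OF \<tau>(1)])
qed

lemma compact_neighbourhood:
  obtains K \<rho> where "compactin mtopology K" "\<rho> > 0"
    "\<And>a y. a \<in> A \<Longrightarrow> y \<in> mspace X \<Longrightarrow> mdist X a y < \<rho> \<Longrightarrow> y \<in> K"
proof -
  have "locally_compact_space mtopology"
    using ifs by (auto simp: ifs_def topology_of_metric)
  then obtain U K where K: "openin mtopology U" "compactin mtopology K" "A \<subseteq> U" "U \<subseteq> K"
    using locally_compact_space_compact_closed_compact[of mtopology] attractor_compact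
      Hausdorff_space_mtopology by meson
  obtain \<rho> where \<rho>: "\<rho> > 0" "\<forall>a\<in>A. mball a \<rho> \<subseteq> U"
    using lebesgue_number[OF attractor_compact, of "{U}"] K by auto
  have "y \<in> K" if "a \<in> A" "y \<in> mspace X" "mdist X a y < \<rho>" for a y
  proof -
    have "y \<in> mball a \<rho>" using that attractor_subset_space by auto
    then show ?thesis using \<rho>(2) that(1) K(4) by blast
  qed
  then show thesis by (rule that[OF K(2) \<rho>(1)])
qed

text \<open>
  Shadowing is only available for bounded lengths. It suffices to control lengths between
  \<open>\<tau>\<close> and \<open>2 * \<tau>\<close>, where \<open>\<tau>\<close> is the time \<open>K\<close> takes to come within \<open>\<rho>/2\<close> of the attractor: such a
  chain ends \<open>\<rho>\<close>-near the attractor, thus in \<open>K\<close> again, and a longer chain can be cut into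
  pieces of this kind.
\<close>

lemma capture_near_neighbourhood:
  assumes K: "compactin mtopology K" "\<rho> > 0"
    and nbhd: "\<And>a y. a \<in> A \<Longrightarrow> y \<in> mspace X \<Longrightarrow> mdist X a y < \<rho> \<Longrightarrow> y \<in> K"
  obtains N \<epsilon> where "\<epsilon> > 0"
    "\<And>x y n. x \<in> K \<Longrightarrow> n \<ge> N \<Longrightarrow> (step \<epsilon> ^^ n) x y \<Longrightarrow> \<exists>a\<in>A. mdist X a y < \<rho>"
proof -
  obtain \<tau> where \<tau>: "\<tau> > 0"
    "\<And>n v. n \<ge> \<tau> \<Longrightarrow> v \<in> (hutchinson m f ^^ n) K \<Longrightarrow> \<exists>a\<in>A. mdist X v a < \<rho>/2"
    using attracts_compact[OF K(1) half_gt_zero[OF K(2)]] by metis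
  have "\<forall>n. \<exists>\<epsilon>>0. \<forall>x\<in>K. \<forall>y. (step \<epsilon> ^^ n) x y \<longrightarrow>
      (\<exists>v\<in>(hutchinson m f ^^ n) K. mdist X v y < \<rho>/2)"
    using shadowing[OF K(1) half_gt_zero[OF K(2)]] by blast
  then obtain e where e: "\<And>n. e n > 0"
    "\<And>n x y. x \<in> K \<Longrightarrow> (step (e n) ^^ n) x y \<Longrightarrow>
       \<exists>v\<in>(hutchinson m f ^^ n) K. mdist X v y < \<rho>/2"
    by metis
  \<comment> \<open>one tolerance for all the finitely many lengths below \<open>2 * \<tau>\<close>\<close>
  define \<epsilon> where "\<epsilon> = Min (e ` {..<2*\<tau>})"
  have ne: "{..<2*\<tau>} \<noteq> {}" using \<tau>(1) by (simp add: lessThan_empty_iff)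
  have \<epsilon>: "\<epsilon> > 0" "\<And>n. n < 2*\<tau> \<Longrightarrow> \<epsilon> \<le> e n"
    using e(1) ne unfolding \<epsilon>_def by auto
  have short: "\<exists>a\<in>A. mdist X a y < \<rho>"
    if c: "x \<in> K" "\<tau> \<le> n" "n < 2*\<tau>" "(step \<epsilon> ^^ n) x y" for x y n
  proof -
    have "(step (e n) ^^ n) x y"
      using c(4) \<epsilon>(2)[OF c(3)] by (rule relpowp_pseudo_step_mono)
    then obtain v where v: "v \<in> (hutchinson m f ^^ n) K" "mdist X v y < \<rho>/2"
      using e(2) c(1) by blast
    obtain a where a: "a \<in> A" "mdist X v a < \<rho>/2" using \<tau>(2)[OF c(2) v(1)] by blast
    have "compactin mtopology ((hutchinson m f ^^ n) K)"
      by (induction n) (auto intro: K(1) compactin_hutchinson)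
    then have "v \<in> mspace X" using v(1) compactin_subset_topspace by fastforce
    moreover have "y \<in> mspace X"
      using relpowp_pseudo_step_in_space[OF c(4)] c(1) compactin_subset_topspace[OF K(1)] by auto
    ultimately have "mdist X a y \<le> mdist X v a + mdist X v y"
      using a(1) attractor_subset_space triangle''[of a v y] by blast
    then show ?thesis using a v(2) by force
  qed
  have "\<exists>a\<in>A. mdist X a y < \<rho>" if "x \<in> K" "\<tau> \<le> n" "(step \<epsilon> ^^ n) x y" for x y n
    using that
  proof (induction n arbitrary: x rule: less_induct)
    case (less n)
    show ?case
    proof (cases "n < 2*\<tau>")
      case True
      then show ?thesis using short less.prems by blast
    next
      case False
      then have "n = \<tau> + (n - \<tau>)" by simp
      then have "((step \<epsilon> ^^ \<tau>) OO (step \<epsilon> ^^ (n - \<tau>))) x y"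
        using less.prems(3) relpowp_add by metis
      then obtain z where z: "(step \<epsilon> ^^ \<tau>) x z" "(step \<epsilon> ^^ (n - \<tau>)) z y" by blast
      obtain a where "a \<in> A" "mdist X a z < \<rho>"
        using short[OF less.prems(1) _ _ z(1)] \<tau>(1) by auto
      moreover have "z \<in> mspace X"
        using relpowp_pseudo_step_in_space[OF z(1)] less.prems(1)
          compactin_subset_topspace[OF K(1)] by auto
      ultimately have "z \<in> K" using nbhd by blast
      then show ?thesis using less.IH[OF _ _ _ z(2)] False \<tau>(1) by auto
    qed
  qed
  then show thesis by (rule that[OF \<epsilon>(1)])
qed

text \<open>
  A compact neighbourhood of the attractor enlarged by \<open>x\<close> is still one, so the starting point
  may be arbitrary.
\<close>

lemma capture:
  assumes "x \<in> mspace X" "\<rho> > 0"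
  obtains N \<epsilon> where "\<epsilon> > 0"
    "\<And>y n. n \<ge> N \<Longrightarrow> (step \<epsilon> ^^ n) x y \<Longrightarrow> \<exists>a\<in>A. mdist X a y < \<rho>"
proof -
  obtain K \<sigma> where K: "compactin mtopology K" "\<sigma> > 0"
    "\<And>a y. a \<in> A \<Longrightarrow> y \<in> mspace X \<Longrightarrow> mdist X a y < \<sigma> \<Longrightarrow> y \<in> K"
    using compact_neighbourhood by metis
  have "compactin mtopology (K \<union> {x})" using K(1) assms(1) by (intro compactin_Un) auto
  moreover have "min \<rho> \<sigma> > 0" using assms K by simp
  ultimately obtain N \<epsilon> where N: "\<epsilon> > 0"
    "\<And>x' y n. x' \<in> K \<union> {x} \<Longrightarrow> n \<ge> N \<Longrightarrow> (step \<epsilon> ^^ n) x' y \<Longrightarrow> \<exists>a\<in>A. mdist X a y < min \<rho> \<sigma>"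
    by (rule capture_near_neighbourhood) (use K(3) in auto)
  show thesis
  proof (rule that[OF N(1)])
    fix y n assume "n \<ge> N" "(step \<epsilon> ^^ n) x y"
    then show "\<exists>a\<in>A. mdist X a y < \<rho>" using N(2)[of x n y] by auto
  qed
qed

section \<open>The downstream set of a chain-recurrent point\<close>

lemma downstream_set_subset_attractor:
  assumes "x \<in> R"
  shows "D x \<subseteq> A"
proof
  fix y assume y: "y \<in> D x"
  have x: "x \<in> mspace X" using y by (simp add: in_downstream_set_iff)
  have yX: "y \<in> mspace X" using y downstream_set_subset_space by auto
  have "\<exists>a\<in>A. mdist X a y < \<rho>" if \<rho>: "\<rho> > 0" for \<rho>
  proof -
    obtain N \<epsilon> where N: "\<epsilon> > 0"
      "\<And>y n. n \<ge> N \<Longrightarrow> (step \<epsilon> ^^ n) x y \<Longrightarrow> \<exists>a\<in>A. mdist X a y < \<rho>"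
      using capture[OF x \<rho>] by metis
    obtain n where "n \<ge> N" "(step \<epsilon> ^^ n) x y"
      using long_chain_from_recurrent[OF assms y N(1)] by metis
    then show ?thesis using N(2) by blast
  qed
  then show "y \<in> A"
    using mem_closedin_if_approximated yX compactin_imp_closedin[OF Hausdorff_space_mtopology attractor_compact] by blast
qed

lemma downstream_set_in_hyperspace:
  assumes "x \<in> R"
  shows "D x \<in> compact_hyperspace X"
proof -
  have "x \<in> D x"
    using assms downstream_refl unfolding chain_recurrent_set_def downstream_set_def by auto
  moreover have "compactin mtopology (D x)"
    using closed_compactin[OF attractor_compact downstream_set_subset_attractor[OF assms]
        closedin_downstream_set] .
  ultimately show ?thesis unfolding compact_hyperspace_def topology_of_metric by auto
qed

text \<open>
  Chains to \<open>y\<close> can be taken so long that cutting off the last step still leaves a captured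
  chain. This confines the penultimate points to one compact set, so that they accumulate; the
  non-zero length of what remains allows its endpoint to be moved to a limit point.
\<close>

lemma predecessor_in_compact:
  assumes "x \<in> R" "y \<in> D x"
  obtains K where "compactin mtopology K"
    "\<And>e. e > 0 \<Longrightarrow> \<exists>w\<in>K. (\<exists>k. (step e ^^ Suc k) x w) \<and> step e w y"
proof -
  have x: "x \<in> mspace X" using assms(2) by (simp add: in_downstream_set_iff)
  obtain K \<rho> where K: "compactin mtopology K" "\<rho> > 0"
    "\<And>a y. a \<in> A \<Longrightarrow> y \<in> mspace X \<Longrightarrow> mdist X a y < \<rho> \<Longrightarrow> y \<in> K"
    using compact_neighbourhood by metis
  obtain N \<epsilon> where N: "\<epsilon> > 0"
    "\<And>y n. n \<ge> N \<Longrightarrow> (step \<epsilon> ^^ n) x y \<Longrightarrow> \<exists>a\<in>A. mdist X a y < \<rho>"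
    using capture[OF x K(2)] by metis
  have "\<exists>w\<in>K. (\<exists>k. (step e ^^ Suc k) x w) \<and> step e w y" if e: "e > 0" for e
  proof -
    have e': "min e \<epsilon> > 0" using e N(1) by simp
    obtain n where n: "n \<ge> Suc (Suc N)" "(step (min e \<epsilon>) ^^ n) x y"
      using long_chain_from_recurrent[OF assms e'] by metis
    \<comment> \<open>a chain of length \<open>k + 1 \<ge> N\<close> remains after its last step is removed\<close>
    define k where "k = n - 2"
    have k: "n = Suc (Suc k)" "Suc k \<ge> N" using n(1) by (auto simp: k_def)
    obtain w where w: "(step (min e \<epsilon>) ^^ Suc k) x w" "step (min e \<epsilon>) w y"
      using n(2) unfolding k(1) by (rule relpowp_Suc_E)
    have c: "(step \<epsilon> ^^ Suc k) x w" "(step e ^^ Suc k) x w"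
      by (rule relpowp_pseudo_step_mono[OF w(1)], simp)+
    have "w \<in> mspace X" using w(2) by (simp add: pseudo_step_def)
    then have "w \<in> K" using N(2)[OF k(2) c(1)] K(3) by blast
    moreover have "step e w y" using w(2) by (auto simp: pseudo_step_def)
    ultimately show ?thesis using c(2) by blast
  qed
  then show thesis by (rule that[OF K(1)])
qed

lemma hutchinson_downstream_set:
  assumes "x \<in> R"
  shows "hutchinson m f (D x) = D x"
proof (rule subset_antisym[OF hutchinson_downstream_subset subsetI])
  fix y assume y: "y \<in> D x"
  have x: "x \<in> mspace X" using y by (simp add: in_downstream_set_iff)
  have yX: "y \<in> mspace X" using y downstream_set_subset_space by auto
  obtain K where K: "compactin mtopology K"
    "\<And>e. e > 0 \<Longrightarrow> \<exists>w\<in>K. (\<exists>k. (step e ^^ Suc k) x w) \<and> step e w y"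
    using predecessor_in_compact[OF assms y] by metis
  define P where "P e w \<longleftrightarrow> (\<exists>k. (step e ^^ Suc k) x w) \<and> step e w y" for e w
  have P: "\<exists>w\<in>K. P e w" if "e > 0" for e using K(2)[OF that] unfolding P_def .
  have mono: "P e' w" if Pe: "P e w" and le: "e \<le> e'" for e e' w
  proof -
    obtain k where "(step e ^^ Suc k) x w" "(step e ^^ 1) w y"
      using Pe unfolding P_def relpowp_1 by blast
    from this[THEN relpowp_pseudo_step_mono, OF le] show ?thesis
      unfolding P_def relpowp_1 by blast
  qed
  have "\<exists>l\<in>K. \<forall>e>0. \<exists>w. P e w \<and> mdist X w l < e"
    by (rule cluster_point[OF K(1), of P]) (fact P, fact mono)
  then obtain l where l: "l \<in> K" "\<And>e. e > 0 \<Longrightarrow> \<exists>w. P e w \<and> mdist X w l < e" by blast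
  have lX: "l \<in> mspace X" using l(1) compactin_subset_topspace[OF K(1)] by auto
  have "l \<in> D x"
    unfolding in_downstream_set_iff
  proof (intro conjI allI impI x)
    fix e :: real assume e: "e > 0"
    obtain w k where w: "(step (e/2) ^^ Suc k) x w" "mdist X w l < e/2"
      using l(2)[OF half_gt_zero[OF e]] unfolding P_def by blast
    have "(step (e/2 + e/2) ^^ Suc k) x l" by (rule perturb_end[OF w lX])
    then have "(step e ^^ Suc k) x l" by (simp only: field_sum_of_halves)
    then show "\<exists>n. (step e ^^ n) x l" by blast
  qed
  moreover have "y \<in> hutchinson m f {l}"
  proof -
    have "compactin mtopology {l}" using lX by simp
    then have "closedin mtopology (hutchinson m f {l})"
      using compactin_hutchinson compactin_imp_closedin Hausdorff_space_mtopology by blast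
    moreover have "\<exists>v\<in>hutchinson m f {l}. mdist X v y < \<delta>" if \<delta>: "\<delta> > 0" for \<delta>
    proof -
      obtain \<eta> where \<eta>: "\<eta> > 0"
        "\<And>x y z. x \<in> {l} \<Longrightarrow> mdist X x y < \<eta> \<Longrightarrow> step \<eta> y z \<Longrightarrow>
           \<exists>v\<in>hutchinson m f {l}. mdist X v z < \<delta>"
        using shadowing_step[OF \<open>compactin mtopology {l}\<close> \<delta>] by metis
      obtain w where w: "step \<eta> w y" "mdist X w l < \<eta>" using l(2)[OF \<eta>(1)] unfolding P_def by blast
      then show ?thesis using \<eta>(2)[of l w y] by (simp add: commute)
    qed
    ultimately show ?thesis using mem_closedin_if_approximated yX by blast
  qed
  ultimately show "y \<in> hutchinson m f (D x)" by (auto simp: hutchinson_def)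
qed

section \<open>Existence of chain-recurrent points\<close>

lemma word_map_attractor: "I \<in> lists {1..m} \<Longrightarrow> a \<in> A \<Longrightarrow> word_map f I a \<in> A"
proof (induction I)
  case (Cons i I)
  then have "f i (word_map f I a) \<in> hutchinson m f A" by (auto simp: hutchinson_def)
  then show ?case using attractor_invariant by simp
qed simp

text \<open>
  Zorn's lemma yields maximal rather than minimal elements, so it is applied to the complements of
  the downstream sets in \<open>A\<close>. A chain of downstream sets has the finite intersection property
  in \<open>A\<close>, and the downstream set of any common point lies below the whole chain.
\<close>

lemma minimal_downstream_point:
  obtains x where "x \<in> A" "\<And>z. z \<in> A \<Longrightarrow> z \<in> D x \<Longrightarrow> x \<in> D z"
proof -
  let ?F = "(\<lambda>x. A - D x) ` A"
  have self: "x \<in> D x" if "x \<in> A" for x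
    unfolding downstream_set_def mem_Collect_eq
    by (rule downstream_refl[OF subsetD[OF attractor_subset_space that]])
  have mono: "D y \<subseteq> D x" if "y \<in> D x" for x y
    using that by (intro downstream_set_mono) (simp add: downstream_set_def)
  have "\<exists>M\<in>?F. \<forall>Z\<in>?F. M \<subseteq> Z \<longrightarrow> Z = M"
  proof (rule subset_Zorn)
    fix C assume C: "subset.chain ?F C"
    define U where "U = {D x | x. x \<in> A \<and> A - D x \<in> C}"
    have cl: "closedin mtopology S" if "S \<in> U" for S
      using that closedin_downstream_set unfolding U_def by auto
    have fin: "A \<inter> \<Inter>G \<noteq> {}" if G: "finite G" "G \<subseteq> U" for G
    proof (cases "G = {}")
      case True
      then show ?thesis using attractor_nonempty by simp
    next
      case False
      let ?G = "(\<lambda>S. A - S) ` G"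
      have sub: "?G \<subseteq> C" using G(2) unfolding U_def by auto
      \<comment> \<open>\<open>?G\<close> is a finite piece of the chain \<open>C\<close>, so its maximal element is its largest; the
        point defining it lies in all the downstream sets in \<open>G\<close>\<close>
      obtain M where M: "M \<in> ?G" "\<And>B. B \<in> ?G \<Longrightarrow> M \<subseteq> B \<Longrightarrow> M = B"
        using finite_has_maximal[of ?G] G(1) False by auto
      obtain x where x: "x \<in> A" "M = A - D x" using M(1) G(2) unfolding U_def by auto
      have "B \<subseteq> M" if "B \<in> ?G" for B
      proof -
        have "B \<in> C" "M \<in> C" using sub that M(1) by auto
        then have "B \<subseteq> M \<or> M \<subseteq> B" using C unfolding subset_chain_def by blast
        then show ?thesis using M(2)[OF that] by blast
      qed
      then have "x \<in> S" if "S \<in> G" for S using that x self[OF x(1)] by blast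
      then show ?thesis using x(1) by blast
    qed
    have "A \<inter> \<Inter>U \<noteq> {}"
      using attractor_compact cl fin unfolding compactin_fip by blast
    then obtain y where y: "y \<in> A" "\<And>S. S \<in> U \<Longrightarrow> y \<in> S" by blast
    have "Z \<subseteq> A - D y" if "Z \<in> C" for Z
    proof -
      obtain x where x: "x \<in> A" "Z = A - D x" using C \<open>Z \<in> C\<close> unfolding subset_chain_def by blast
      then have "y \<in> D x" using y(2) \<open>Z \<in> C\<close> unfolding U_def by blast
      then show ?thesis using mono x(2) by blast
    qed
    then show "\<exists>M\<in>?F. \<forall>Z\<in>C. Z \<subseteq> M" using y(1) by blast
  qed
  then obtain x where x: "x \<in> A" "\<And>z. z \<in> A \<Longrightarrow> A - D x \<subseteq> A - D z \<Longrightarrow> A - D z = A - D x"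
    by blast
  have "x \<in> D z" if "z \<in> A" "z \<in> D x" for z
    using x(2)[OF that(1)] mono[OF that(2)] self[OF x(1)] x(1) by blast
  then show thesis by (rule that[OF x(1)])
qed

lemma chain_recurrent_point_exists: "R \<noteq> {}"
proof -
  obtain x where x: "x \<in> A" "\<And>z. z \<in> A \<Longrightarrow> z \<in> D x \<Longrightarrow> x \<in> D z"
    using minimal_downstream_point by metis
  have xX: "x \<in> mspace X" using x(1) attractor_subset_space by blast
  have "x \<in> D z" if z: "z \<in> orbit m f x" for z
  proof -
    obtain I where I: "I \<in> lists {1..m}" "z = word_map f I x" using z by (auto simp: orbit_def)
    have "z \<in> D x"
      using word_map_chain[OF I(1) xX] xX unfolding in_downstream_set_iff I(2) by blast
    then show ?thesis using x(2) word_map_attractor[OF I(1) x(1)] I(2) by blast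
  qed
  then show ?thesis using chain_recurrentI[OF xX] by blast
qed

section \<open>Embedding the chain nodes into those of the Hutchinson map\<close>

abbreviation H_recurrent where
  "H_recurrent \<equiv> chain_recurrent_set (hausdorff_metric X) 1 (\<lambda>_. hutchinson m f)"

lemma fixed_point_recurrent:
  assumes "K \<in> compact_hyperspace X" "hutchinson m f K = K"
  shows "K \<in> H_recurrent"
proof -
  have "word_map (\<lambda>_. hutchinson m f) I K = K" for I :: "nat list"
    using assms(2) by (induction I) auto
  then show ?thesis
    using assms(1) downstream_refl[of K "hausdorff_metric X"]
    unfolding chain_recurrent_set_def orbit_def chain_equivalent_def by auto
qed

text \<open>
  The Hausdorff distance bounds how far a point of the next set can be from the image of the
  current one, so each point has a predecessor; the tolerance and the length are preserved.
\<close>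

lemma trace_back_hyperspace_chain:
  assumes "(pseudo_step (hausdorff_metric X) 1 (\<lambda>_. hutchinson m f) \<epsilon> ^^ n) K L" "y \<in> L"
  shows "\<exists>x\<in>K. (step \<epsilon> ^^ n) x y"
  using assms
proof (induction n arbitrary: L y)
  case 0
  then show ?case by auto
next
  case (Suc n)
  let ?H = "hutchinson m f"
  obtain M where M: "(pseudo_step (hausdorff_metric X) 1 (\<lambda>_. ?H) \<epsilon> ^^ n) K M"
    "pseudo_step (hausdorff_metric X) 1 (\<lambda>_. ?H) \<epsilon> M L" using Suc.prems by auto
  then have h: "M \<in> compact_hyperspace X" "L \<in> compact_hyperspace X"
    "hausdorff_dist X (?H M) L < \<epsilon>" by (auto simp: pseudo_step_def)
  have HM: "?H M \<in> compact_hyperspace X" by (rule hutchinson_in_hyperspace[OF ifs h(1)])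
  have "point_set_dist X y (?H M) < \<epsilon>"
    using hausdorff_dist_ge(2)[OF HM h(2) Suc.prems(2)] h(3) by linarith
  then obtain v where v: "v \<in> ?H M" "mdist X y v < \<epsilon>"
    using point_set_dist_approx[OF compact_hyperspaceD(1)[OF HM],
        of "\<epsilon> - point_set_dist X y (?H M)" X y] by auto
  then obtain i w where i: "i \<in> {1..m}" "w \<in> M" "v = f i w" by (auto simp: hutchinson_def)
  have "w \<in> mspace X" "y \<in> mspace X"
    using i(2) Suc.prems(2) compact_hyperspaceD(3) h(1,2) by blast+
  then have "step \<epsilon> w y" using i v(2) unfolding pseudo_step_def by (auto simp: commute)
  moreover obtain x where "x \<in> K" "(step \<epsilon> ^^ n) x w" using Suc.IH[OF M(1) i(2)] by blast
  ultimately show ?case using relpowp_Suc_I by metis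
qed

text \<open>
  Tracing back ends at a point of \<open>D x\<close> that depends on the tolerance. This is harmless,
  since \<open>x\<close> reaches that point with the same tolerance.
\<close>

lemma downstream_subset_if_hyperspace_downstream:
  assumes "downstream (hausdorff_metric X) 1 (\<lambda>_. hutchinson m f) (D x) L"
  shows "L \<subseteq> D x"
proof
  fix y assume y: "y \<in> L"
  have chain: "\<exists>w\<in>D x. \<exists>n. (step e ^^ n) w y" if "e > 0" for e
    using assms that trace_back_hyperspace_chain[OF _ y]
    unfolding downstream_def has_chain_iff_relpowp by blast
  then have x: "x \<in> mspace X" using in_downstream_set_iff zero_less_one by metis
  show "y \<in> D x"
    unfolding in_downstream_set_iff
  proof (intro conjI allI impI x)
    fix e :: real assume e: "e > 0"
    then obtain w n where w: "w \<in> D x" "(step e ^^ n) w y" using chain by blast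
    then obtain k where "(step e ^^ k) x w" using e unfolding in_downstream_set_iff by blast
    then show "\<exists>n. (step e ^^ n) x y" using w(2) relpowp_trans by metis
  qed
qed

lemma hyperspace_equivalent_iff:
  assumes "x \<in> R" "y \<in> R"
  shows "chain_equivalent (hausdorff_metric X) 1 (\<lambda>_. hutchinson m f) (D x) (D y) \<longleftrightarrow>
    chain_equivalent X m f x y"
proof -
  have xy: "x \<in> mspace X" "y \<in> mspace X"
    using assms by (auto simp: chain_recurrent_set_def)
  have "chain_equivalent (hausdorff_metric X) 1 (\<lambda>_. hutchinson m f) (D x) (D y) \<longleftrightarrow> D x = D y"
    using downstream_subset_if_hyperspace_downstream[of x "D y"]
      downstream_subset_if_hyperspace_downstream[of y "D x"]
      downstream_refl[of "D x" "hausdorff_metric X" 1] downstream_set_in_hyperspace[OF assms(1)]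
    unfolding chain_equivalent_def by auto
  then show ?thesis using downstream_set_eq_iff[OF xy] by simp
qed

lemma chain_nodes_lepoll:
  "chain_nodes X m f \<lesssim> chain_nodes (hausdorff_metric X) 1 (\<lambda>_. hutchinson m f)"
proof -
  let ?E = "{(x, y). x \<in> R \<and> y \<in> R \<and> chain_equivalent X m f x y}"
  let ?E' = "{(K, L). K \<in> H_recurrent \<and> L \<in> H_recurrent \<and>
    chain_equivalent (hausdorff_metric X) 1 (\<lambda>_. hutchinson m f) K L}"
  note eq = chain_equivalent_on_recurrent_set[of X m f]
  note eq' = chain_equivalent_on_recurrent_set[of "hausdorff_metric X" 1 "\<lambda>_. hutchinson m f"]
  have rec: "D x \<in> H_recurrent" if "x \<in> R" for x
    using fixed_point_recurrent downstream_set_in_hyperspace hutchinson_downstream_set that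
    by blast
  \<comment> \<open>a representative of each node of the system\<close>
  define rep where "rep N = (SOME x. x \<in> N)" for N :: "'a set"
  have rep: "rep N \<in> N" "rep N \<in> R" if "N \<in> R // ?E" for N
  proof -
    show "rep N \<in> N"
      using in_quotient_imp_non_empty[OF eq that] unfolding rep_def by (auto intro: someI)
    then show "rep N \<in> R" using in_quotient_imp_subset[OF eq that] by blast
  qed
  have "inj_on (\<lambda>N. ?E' `` {D (rep N)}) (R // ?E)"
  proof (rule inj_onI)
    fix M N assume MN: "M \<in> R // ?E" "N \<in> R // ?E"
      and same: "?E' `` {D (rep M)} = ?E' `` {D (rep N)}"
    have "(D (rep M), D (rep N)) \<in> ?E'"
      using eq_equiv_class[OF same eq'] rec rep(2) MN by blast
    then have "(rep M, rep N) \<in> ?E"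
      using hyperspace_equivalent_iff rep(2) MN by blast
    then show "M = N" using quotient_eqI[OF eq MN] rep(1) MN by blast
  qed
  moreover have "(\<lambda>N. ?E' `` {D (rep N)}) ` (R // ?E) \<subseteq> H_recurrent // ?E'"
    using rec rep(2) quotientI[of _ H_recurrent ?E'] by blast
  ultimately show ?thesis unfolding lepoll_def chain_nodes_def by blast
qed

lemma chain_nodes_nonempty: "chain_nodes X m f \<noteq> {}"
  using chain_recurrent_point_exists unfolding chain_nodes_def by (auto simp: quotient_def)

end

theorem theorem5:
  fixes X :: "'a metric" and m :: nat and f :: "nat \<Rightarrow> 'a \<Rightarrow> 'a"
  assumes "ifs X m f"
    and "compact_dynamics X m f"
  shows "pverts (chain_graph X m f) \<lesssim> pverts (hutchinson_chain_graph X m f) \<and>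
    ((\<exists>!M. M \<in> pverts (hutchinson_chain_graph X m f)) \<longrightarrow>
     (\<exists>!M. M \<in> pverts (chain_graph X m f)))"
proof -
  obtain A where "global_attractor X m f A"
    using assms(2) unfolding compact_dynamics_def by blast
  then interpret ifs_with_attractor X m f A
    using assms(1) by unfold_locales
  have le: "pverts (chain_graph X m f) \<lesssim> pverts (hutchinson_chain_graph X m f)"
    using chain_nodes_lepoll unfolding chain_graph_def hutchinson_chain_graph_def by simp
  have ne: "pverts (chain_graph X m f) \<noteq> {}"
    using chain_nodes_nonempty unfolding chain_graph_def by simp
  have "\<exists>!M. M \<in> pverts (chain_graph X m f)"
    if "\<exists>!M. M \<in> pverts (hutchinson_chain_graph X m f)"
  proof -
    obtain h where h: "inj_on h (pverts (chain_graph X m f))"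
      "h ` pverts (chain_graph X m f) \<subseteq> pverts (hutchinson_chain_graph X m f)"
      using le unfolding lepoll_def by blast
    then have "M = N" if "M \<in> pverts (chain_graph X m f)" "N \<in> pverts (chain_graph X m f)" for M N
      using that \<open>\<exists>!M. M \<in> pverts (hutchinson_chain_graph X m f)\<close> by (metis image_subset_iff inj_onD)
    then show ?thesis using ne by blast
  qed
  with le show ?thesis by blast
qed

end
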